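(* Let $n\ge 1$ and let $X=(x_1,\dots,x_{n+1})$ be an ordered tuple of points of $\mathbb{CH}^n$ with $x_i\neq x_1$ for $2\le i\le n+1$. Put $$\rho(X)=(\delta(x_1,x_2),\dots,\delta(x_1,x_{n+1})),\qquad \mathcal{M}(X)=\left(\operatorname{kos}_{x_1}(x_i,x_j)\right)_{i,j=2}^{n+1}.$$ Then: (1) Each entry of $\rho(X)$ is strictly between $0$ and $1$, $\mathcal{M}(X)$ has $1$'s on the diagonal, and $\mathcal{M}(X)$ is positive semidefinite. (2) Conversely, given an $n$-tuple $\sigma$ of numbers strictly between $0$ and $1$ and an $n\times n$ complex matrix $\mathcal{N}$ which has $1$'s on the diagonal and is positive semidefinite, there is such a tuple $X$ in $\mathbb{CH}^n$ with $\mathcal{M}(X)=\mathcal{N}$ and $\rho(X)=\sigma$. (3) Given another such ordered tuple $Y=(y_1,\dots,y_{n+1})$ in $\mathbb{CH}^n$, $X$ and $Y$ are congruent if and only if $\mathcal{M}(X)=\mathcal{M}(Y)$ and $\rho(X)=\rho(Y)$.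
   Context: $\mathbb{CH}^n$ is the open unit ball $\mathbb{B}_n\subset\mathbb{C}^n$ with its group $\operatorname{Aut}\mathbb{B}_n$ of biholomorphic automorphisms, and $\langle\langle z,w\rangle\rangle=\sum_i z_i\overline{w_i}$. For $a\in\mathbb{B}_n$, $\phi_a\in\operatorname{Aut}\mathbb{B}_n$ is the involution interchanging $a$ and $0$: $\phi_a(z)=\dfrac{a-P_az-(1-|a|^2)^{1/2}(z-P_az)}{1-\langle\langle z,a\rangle\rangle}$, where $P_a$ is the orthogonal projection of $\mathbb{C}^n$ onto the span of $a$ ($P_0=0$). The pseudohyperbolic metric is $\delta(a,b)=|\phi_a(b)|$. For $y,z\neq x$ in $\mathbb{B}_n$, $\operatorname{kos}_x(y,z)=\left\langle\left\langle \frac{\phi_x(y)}{|\phi_x(y)|},\frac{\phi_x(z)}{|\phi_x(z)|}\right\rangle\right\rangle$. Two ordered tuples of the same length are congruent if some element of $\operatorname{Aut}\mathbb{B}_n$ takes the $j$-th point of the first to the $j$-th point of the second for every $j$. Positive semidefinite matrices are understood to be Hermitian. *)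

theory Defs
  imports "HOL-Analysis.Analysis"
begin

text \<open>
  \<open>\<complex>\<^sup>n\<close> is \<open>complex ^ 'n\<close> with \<open>n = CARD('n) \<ge> 1\<close>; its norm is the Euclidean one.
  The tuple \<open>(x\<^sub>1, \<dots>, x\<^sub>n\<^sub>+\<^sub>1)\<close> is a function \<open>X\<close> on \<open>'n option\<close>, which has \<open>n + 1\<close> elements:
  \<open>X None\<close> is the base point \<open>x\<^sub>1\<close>, and the indices \<open>Some i\<close> play the role of \<open>2, \<dots>, n + 1\<close>.
\<close>

definition herm :: "complex ^ 'n::finite \<Rightarrow> complex ^ 'n \<Rightarrow> complex" where
  "herm z w = (\<Sum>i\<in>UNIV. z $ i * cnj (w $ i))"

text \<open>For \<open>a = 0\<close> the coefficient is \<open>0 / 0 = 0\<close>, so that \<open>proj 0 z = 0\<close>.\<close>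

definition proj :: "complex ^ 'n::finite \<Rightarrow> complex ^ 'n \<Rightarrow> complex ^ 'n" where
  "proj a z = (herm z a / herm a a) *s a"

definition phi :: "complex ^ 'n::finite \<Rightarrow> complex ^ 'n \<Rightarrow> complex ^ 'n" where
  "phi a z = (1 / (1 - herm z a)) *s
     (a - proj a z - complex_of_real (sqrt (1 - (norm a)\<^sup>2)) *s (z - proj a z))"

definition pseudohyp :: "complex ^ 'n::finite \<Rightarrow> complex ^ 'n \<Rightarrow> real" where
  "pseudohyp a b = norm (phi a b)"

definition kos :: "complex ^ 'n::finite \<Rightarrow> complex ^ 'n \<Rightarrow> complex ^ 'n \<Rightarrow> complex" where
  "kos x y z = herm (phi x y /\<^sub>R norm (phi x y)) (phi x z /\<^sub>R norm (phi x z))"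

text \<open>
  Holomorphy in several variables: Frechet differentiability with a complex-linear derivative.
  The library's \<open>holomorphic_on\<close> covers only functions of one complex variable.
\<close>

definition holo_on :: "(complex ^ 'n::finite \<Rightarrow> complex ^ 'n) \<Rightarrow> (complex ^ 'n) set \<Rightarrow> bool" where
  "holo_on f S \<longleftrightarrow> (\<forall>z\<in>S. \<exists>D. (f has_derivative D) (at z within S)
     \<and> Vector_Spaces.linear (*s) (*s) D)"

text \<open>
  Automorphisms are represented by total functions; only their values on the ball are constrained.
\<close>

definition aut_ball :: "(complex ^ 'n::finite \<Rightarrow> complex ^ 'n) set" where
  "aut_ball = {f. bij_betw f (ball 0 1) (ball 0 1) \<and> holo_on f (ball 0 1)
     \<and> holo_on (inv_into (ball 0 1) f) (ball 0 1)}"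

definition congruent_tuples :: "('k \<Rightarrow> complex ^ 'n::finite) \<Rightarrow> ('k \<Rightarrow> complex ^ 'n) \<Rightarrow> bool" where
  "congruent_tuples X Y \<longleftrightarrow> (\<exists>f\<in>aut_ball. \<forall>j. f (X j) = Y j)"

text \<open>For Hermitian \<open>A\<close> the number \<open>\<langle>\<langle>A v, v\<rangle>\<rangle>\<close> is real, so \<open>Re\<close> loses nothing.\<close>

definition psd :: "complex ^ 'n::finite ^ 'n \<Rightarrow> bool" where
  "psd A \<longleftrightarrow> (\<forall>i j. A $ j $ i = cnj (A $ i $ j)) \<and> (\<forall>v. 0 \<le> Re (herm (A *v v) v))"

definition admissible :: "('n option \<Rightarrow> complex ^ 'n::finite) \<Rightarrow> bool" where
  "admissible X \<longleftrightarrow> (\<forall>j. X j \<in> ball 0 1) \<and> (\<forall>i. X (Some i) \<noteq> X None)"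

definition rho :: "('n option \<Rightarrow> complex ^ 'n::finite) \<Rightarrow> real ^ 'n" where
  "rho X = (\<chi> i. pseudohyp (X None) (X (Some i)))"

definition kos_matrix :: "('n option \<Rightarrow> complex ^ 'n::finite) \<Rightarrow> complex ^ 'n ^ 'n" where
  "kos_matrix X = (\<chi> i j. kos (X None) (X (Some i)) (X (Some j)))"

lemma herm_self: "herm a a = complex_of_real ((norm a)\<^sup>2)"
  by (simp add: herm_def norm_vec_def L2_set_def sum_nonneg complex_norm_square del: of_real_power)

lemma herm_self_eq_0_iff: "herm a a = 0 \<longleftrightarrow> a = 0"
  by (simp add: herm_self)

lemma herm_scale_left: "herm (c *s z) w = c * herm z w"
  by (simp add: herm_def sum_distrib_left mult.assoc)

lemma herm_scale_right: "herm z (c *s w) = cnj c * herm z w"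
  by (simp add: herm_def sum_distrib_left mult_ac)

lemma herm_diff_left: "herm (z - z') w = herm z w - herm z' w"
  by (simp add: herm_def sum_subtractf left_diff_distrib)

text \<open>\<open>proj a\<close> is the orthogonal projection onto the complex span of \<open>a\<close>.\<close>

lemma proj_iff:
  "p = proj a z \<longleftrightarrow> p \<in> vec.span {a} \<and> (\<forall>w\<in>vec.span {a}. herm (z - p) w = 0)"
proof (cases "a = 0")
  case True
  then show ?thesis by (auto simp: proj_def herm_def)
next
  case False
  then have "herm a a \<noteq> 0" by (simp add: herm_self_eq_0_iff)
  then show ?thesis
    by (auto simp: proj_def vec.span_singleton herm_diff_left herm_scale_left herm_scale_right
        field_simps)
qed

end

theory Submission
  imports Defs "HOL-Complex_Analysis.Conformal_Mappings"
begin

text \<open>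
  The automorphism \<open>phi x\<^sub>1\<close> moves the base point to \<open>0\<close>, and an automorphism of the ball fixing \<open>0\<close> is
  unitary: applying the Schwarz lemma to the one-variable slices of it and of its inverse shows that it
  preserves norms, and the equality case then shows that it agrees with its derivative at \<open>0\<close>. So
  congruence of tuples means unitary equivalence of the vectors \<open>phi x\<^sub>1 x\<^sub>i\<close>. Their Gram matrix
  is encoded by \<open>rho\<close> and \<open>kos_matrix\<close>, and two families with the same Gram matrix are related by
  a product of complex reflections, which moves the vectors into place one at a time. Realising given
  invariants amounts to writing a positive semidefinite matrix as a Gram matrix, by Cholesky
  elimination.
\<close>

section \<open>The Hermitian form and complex scaling\<close>

lemma herm_add_left: "herm (z + z') w = herm z w + herm z' w"
  by (simp add: herm_def sum.distrib algebra_simps)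

lemma herm_add_right: "herm z (w + w') = herm z w + herm z w'"
  by (simp add: herm_def sum.distrib algebra_simps)

lemma herm_diff_right: "herm z (w - w') = herm z w - herm z w'"
  by (simp add: herm_def sum_subtractf algebra_simps)

lemma herm_zero [simp]: "herm 0 w = 0" "herm z 0 = 0"
  by (simp_all add: herm_def)

lemma herm_commute: "herm w z = cnj (herm z w)"
  by (simp add: herm_def mult.commute)

lemma herm_sum_left: "herm (\<Sum>i\<in>S. f i) w = (\<Sum>i\<in>S. herm (f i) w)"
  by (induction S rule: infinite_finite_induct) (simp_all add: herm_add_left)

lemma herm_sum_right: "herm w (\<Sum>i\<in>S. f i) = (\<Sum>i\<in>S. herm w (f i))"
  by (induction S rule: infinite_finite_induct) (simp_all add: herm_add_right)

lemmas herm_simps = herm_add_left herm_add_right herm_diff_left herm_diff_right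
  herm_scale_left herm_scale_right

lemma scaleR_eq_cscale: "r *\<^sub>R x = complex_of_real r *s (x :: complex ^ 'n::finite)"
  by (simp add: vec_eq_iff scaleR_conv_of_real[where 'a = complex])

lemma norm_cscale: "norm (c *s z) = norm c * norm (z :: complex ^ 'n::finite)"
  by (simp add: norm_vec_def norm_mult L2_set_right_distrib)

lemma Re_herm: "Re (herm z w) = inner z w"
  by (simp add: herm_def inner_vec_def inner_complex_def)

text \<open>Multiplying \<open>w\<close> by \<open>herm z w\<close> makes the product real and
  nonnegative, so the complex Cauchy-Schwarz inequality follows from the one for the real inner
  product \<open>Re (herm z w)\<close>.\<close>

lemma norm_herm_le: "norm (herm z w) \<le> norm z * norm w"
proof -
  define h where "h = herm z w"
  have "herm z (h *s w) = of_real ((norm h)\<^sup>2)"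
    by (simp add: h_def herm_scale_right complex_norm_square mult.commute del: of_real_power)
  then have "(norm h)\<^sup>2 = inner z (h *s w)"
    by (metis Re_complex_of_real Re_herm)
  also have "\<dots> \<le> norm z * norm (h *s w)"
    by (rule norm_cauchy_schwarz)
  finally have "norm h * norm h \<le> norm h * (norm z * norm w)"
    by (simp add: norm_cscale power2_eq_square mult_ac)
  then show ?thesis
    by (cases "norm h = 0") (auto simp: h_def)
qed

lemma cscale_linear_imp_linear:
  assumes "Vector_Spaces.linear (*s) (*s) (D :: complex ^ 'n::finite \<Rightarrow> complex ^ 'm::finite)"
  shows "linear D"
proof -
  interpret D: Vector_Spaces.linear "(*s)" "(*s)" D by fact
  show ?thesis
    by (rule linearI) (simp_all add: D.add D.scale scaleR_eq_cscale)
qed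

lemma cscale_linearI:
  assumes "\<And>x y. D (x + y) = D x + D y" "\<And>c x. D (c *s x) = c *s D x"
  shows "Vector_Spaces.linear (*s) (*s) (D :: complex ^ 'n::finite \<Rightarrow> complex ^ 'm::finite)"
  using assms by (unfold_locales) (simp_all add: vec.scale_right_distrib vec.scale_left_distrib)

lemma bounded_linear_herm_left: "bounded_linear (\<lambda>z. herm z w)"
proof -
  have "linear (\<lambda>z. herm z w)"
    by (rule linearI) (simp_all add: herm_add_left scaleR_eq_cscale herm_scale_left scaleR_conv_of_real[where 'a = complex])
  then show ?thesis by (simp add: linear_conv_bounded_linear)
qed

lemma bounded_bilinear_cscale:
  "bounded_bilinear ((*s) :: complex \<Rightarrow> complex ^ 'n::finite \<Rightarrow> complex ^ 'n)"
proof
  show "\<exists>K. \<forall>a b. norm (a *s (b :: complex ^ 'n)) \<le> norm a * norm b * K"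
    by (rule exI[of _ 1]) (simp add: norm_cscale)
qed (simp_all add: vec_eq_iff algebra_simps)

section \<open>The involutions \<open>phi a\<close>\<close>

text \<open>In coordinates along \<open>a\<close> and orthogonal to \<open>a\<close>, the map is a
  Moebius transformation of the coefficient and a rescaling of the orthogonal part. Identities for
  \<open>phi\<close> thereby become scalar algebra.\<close>

lemma phi_decomp:
  assumes "herm z' a = 0"
  shows "phi a (c *s a + z') = (1 / (1 - c * herm a a)) *s
           ((1 - c) *s a - complex_of_real (sqrt (1 - (norm a)\<^sup>2)) *s z')"
proof (cases "a = 0")
  case True
  then show ?thesis by (simp add: phi_def proj_def)
next
  case False
  then have "proj a (c *s a + z') = c *s a"
    using assms by (simp add: proj_def herm_simps herm_self)
  then show ?thesis
    using assms by (simp add: phi_def herm_simps vec.scale_left_diff_distrib)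
qed

lemma orthogonal_decomp:
  obtains c z' where "z = c *s a + z'" "herm z' a = 0"
proof
  show "z = (herm z a / herm a a) *s a + (z - (herm z a / herm a a) *s a)" by simp
  show "herm (z - (herm z a / herm a a) *s a) a = 0"
    by (cases "a = 0") (simp_all add: herm_simps herm_self_eq_0_iff)
qed

text \<open>Cauchy-Schwarz gives the product modulus below 1, which keeps the denominators of
  \<open>phi\<close> from vanishing on the ball.\<close>

lemma herm_ne_1:
  assumes "z \<in> ball 0 1" "w \<in> ball 0 1"
  shows "1 - herm z w \<noteq> 0"
proof -
  have "norm (herm z w) \<le> norm z * norm w" by (rule norm_herm_le)
  also have "\<dots> < 1 * 1" using assms by (intro mult_strict_mono') auto
  finally show ?thesis by auto
qed

lemma sqrt_norm_sq:
  assumes "a \<in> ball 0 1"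
  defines "s \<equiv> complex_of_real (sqrt (1 - (norm a)\<^sup>2))"
  shows "s * s = 1 - herm a a"
proof -
  have "(norm a)\<^sup>2 \<le> 1" using assms(1) by (simp add: power_le_one_iff)
  then show ?thesis
    unfolding s_def herm_self by (simp flip: of_real_mult)
qed

text \<open>Splitting \<open>z\<close> and \<open>w\<close> along \<open>a\<close> turns both sides
  into rational expressions in \<open>c\<close>, \<open>cnj d\<close>, \<open>A\<close> and
  \<open>herm z' w'\<close>; clearing denominators leaves a polynomial identity.\<close>

lemma herm_phi:
  assumes a: "a \<in> ball 0 1" and z: "z \<in> ball 0 1" and w: "w \<in> ball 0 1"
  shows "1 - herm (phi a z) (phi a w) =
    (1 - herm a a) * (1 - herm z w) / ((1 - herm z a) * (1 - herm a w))"
proof -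
  obtain c z' where Z: "z = c *s a + z'" "herm z' a = 0" by (rule orthogonal_decomp)
  obtain d w' where W: "w = d *s a + w'" "herm w' a = 0" by (rule orthogonal_decomp)
  define s where "s = complex_of_real (sqrt (1 - (norm a)\<^sup>2))"
  have ss: "s * (s * x) = (1 - herm a a) * x" for x
    using sqrt_norm_sq[OF a] by (simp add: s_def flip: mult.assoc)
  have cs: "cnj s = s" by (simp add: s_def)
  have Z': "herm a z' = 0" "herm a w' = 0" using Z W herm_commute by (metis complex_cnj_zero)+
  have A: "cnj (herm a a) = herm a a" by (simp add: herm_self)
  define A where "A = herm a a"
  have [simp]: "cnj A = A" using A by (simp add: A_def)
  have az: "1 - c * A \<noteq> 0" using herm_ne_1[OF z a] Z by (simp add: herm_simps A_def)
  have aw: "1 - cnj d * A \<noteq> 0" using herm_ne_1[OF a w] W Z' by (simp add: herm_simps A_def)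
  have "herm ((1 - c) *s a - s *s z') ((1 - d) *s a - s *s w')
      = (1 - c) * (1 - cnj d) * A + (1 - A) * herm z' w'"
    using Z' Z(2) W(2) by (simp add: herm_simps cs ss) (simp add: algebra_simps A_def)
  then have "herm (phi a z) (phi a w) =
    ((1 - c) * (1 - cnj d) * A + (1 - A) * herm z' w') / ((1 - c * A) * (1 - cnj d * A))"
    unfolding Z W phi_decomp[OF Z(2)] phi_decomp[OF W(2)]
    by (simp only: herm_scale_left herm_scale_right flip: s_def A_def) simp
  moreover have "herm z w = c * cnj d * A + herm z' w'" "herm z a = c * A" "herm a w = cnj d * A"
    using Z W Z' by (simp_all add: herm_simps A_def)
  moreover have "1 - N / D = M / D" if "D \<noteq> 0" "D - N = M" for N D M :: complex
    using that by (auto simp: diff_divide_distrib)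
  moreover have "(1 - c * A) * (1 - cnj d * A) - ((1 - c) * (1 - cnj d) * A + (1 - A) * herm z' w')
      = (1 - A) * (1 - (c * cnj d * A + herm z' w'))"
    by (simp add: algebra_simps)
  ultimately show ?thesis
    using az aw unfolding A_def[symmetric] by (metis mult_eq_0_iff)
qed

text \<open>The coefficient map from \<open>c\<close> to \<open>c2\<close> is an involution, and the
  two factors by which the orthogonal part is scaled multiply to 1 because
  \<open>s * s = 1 - A\<close>.\<close>

lemma phi_phi:
  assumes a: "a \<in> ball 0 1" and z: "z \<in> ball 0 1"
  shows "phi a (phi a z) = z"
proof -
  obtain c z' where Z: "z = c *s a + z'" "herm z' a = 0" by (rule orthogonal_decomp)
  define s where "s = complex_of_real (sqrt (1 - (norm a)\<^sup>2))"
  define A where "A = herm a a"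
  have ss: "s * s = 1 - A"
    using sqrt_norm_sq[OF a] by (simp add: s_def A_def)
  have az: "1 - c * A \<noteq> 0" using herm_ne_1[OF z a] Z by (simp add: herm_simps A_def)
  have aa: "1 - A \<noteq> 0" using herm_ne_1[OF a a] by (simp add: A_def)
  define c2 where "c2 = (1 - c) / (1 - c * A)"
  define k where "k = - s / (1 - c * A)"
  have p: "phi a z = c2 *s a + k *s z'"
    unfolding Z phi_decomp[OF Z(2)] by (simp add: vec_eq_iff c2_def k_def A_def s_def field_simps diff_divide_distrib)
  have o: "herm (k *s z') a = 0" using Z by (simp add: herm_simps)
  have d: "1 - c2 * A = (1 - A) / (1 - c * A)" using az by (simp add: c2_def field_simps)
  have c': "1 - c2 = c * ((1 - A) / (1 - c * A))" using az by (simp add: c2_def field_simps)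
  have c: "(1 - c2) / (1 - c2 * A) = c"
    unfolding d c' using az aa by simp
  have k: "- s * k / (1 - c2 * A) = 1"
    unfolding d using az aa ss by (simp add: k_def)
  have "phi a (phi a z) = ((1 - c2) / (1 - c2 * A)) *s a + (- s * k / (1 - c2 * A)) *s z'"
    unfolding p phi_decomp[OF o] by (simp add: vec_eq_iff A_def s_def diff_divide_distrib algebra_simps)
  then show ?thesis unfolding c k by (simp add: Z)
qed

lemma phi_self: "phi a a = 0"
  using phi_decomp[of 0 a 1] by simp

lemma phi_0_right: "phi a 0 = a"
  using phi_decomp[of 0 a 0] by simp

lemma phi_0_left: "phi 0 z = - z"
  by (simp add: phi_def proj_def)

text \<open>For \<open>z = w\<close> the identity \<open>herm_phi\<close> writes
  \<open>1 - |phi a z|^2\<close> as a quotient of positive numbers.\<close>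

lemma phi_in_ball:
  assumes a: "a \<in> ball 0 1" and z: "z \<in> ball 0 1"
  shows "phi a z \<in> ball 0 1"
proof -
  have *: "herm a z = cnj (herm z a)" by (rule herm_commute)
  have "complex_of_real (1 - (norm (phi a z))\<^sup>2) =
    complex_of_real ((1 - (norm a)\<^sup>2) * (1 - (norm z)\<^sup>2) / (norm (1 - herm z a))\<^sup>2)"
    using herm_phi[OF a z z] unfolding herm_self of_real_divide complex_norm_square * by simp
  then have "1 - (norm (phi a z))\<^sup>2 = (1 - (norm a)\<^sup>2) * (1 - (norm z)\<^sup>2) / (norm (1 - herm z a))\<^sup>2"
    using of_real_eq_iff by blast
  also have "\<dots> > 0"
    using a z herm_ne_1[OF z a] by (intro divide_pos_pos mult_pos_pos) (auto simp: abs_square_less_1)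
  finally show ?thesis by (simp add: abs_square_less_1)
qed

section \<open>Holomorphic maps and automorphisms of the ball\<close>

lemma holo_onD:
  assumes "holo_on f S" "z \<in> S"
  obtains D where "(f has_derivative D) (at z within S)" "Vector_Spaces.linear (*s) (*s) D"
  using assms unfolding holo_on_def by blast

lemma holo_on_cong:
  assumes "holo_on f S" "\<And>z. z \<in> S \<Longrightarrow> f z = g z"
  shows "holo_on g S"
  unfolding holo_on_def
proof
  fix z assume z: "z \<in> S"
  then obtain D where "(f has_derivative D) (at z within S)" "Vector_Spaces.linear (*s) (*s) D"
    using assms(1) holo_onD by blast
  then show "\<exists>D. (g has_derivative D) (at z within S) \<and> Vector_Spaces.linear (*s) (*s) D"
    using has_derivative_transform[of z S g f D] z assms(2) by auto
qed

lemma holo_on_compose: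
  assumes f: "holo_on f S" and g: "holo_on g T" and st: "f ` S \<subseteq> T"
  shows "holo_on (g \<circ> f) S"
  unfolding holo_on_def
proof
  fix z assume z: "z \<in> S"
  obtain D where D: "(f has_derivative D) (at z within S)" "Vector_Spaces.linear (*s) (*s) D"
    using f z by (rule holo_onD)
  obtain E where E: "(g has_derivative E) (at (f z) within T)" "Vector_Spaces.linear (*s) (*s) E"
    using g z st holo_onD by (metis image_subset_iff)
  have "(g has_derivative E) (at (f z) within f ` S)"
    using E(1) st by (rule has_derivative_subset)
  then have "(g \<circ> f has_derivative E \<circ> D) (at z within S)"
    using D(1) diff_chain_within by blast
  moreover have "Vector_Spaces.linear (*s) (*s) (E \<circ> D)"
    using D(2) E(2) Vector_Spaces.linear_compose by blast
  ultimately show "\<exists>D. (g \<circ> f has_derivative D) (at z within S) \<and> Vector_Spaces.linear (*s) (*s) D"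
    by blast
qed

lemma holo_on_linear:
  assumes "Vector_Spaces.linear (*s) (*s) U"
  shows "holo_on U S"
  unfolding holo_on_def
  using assms cscale_linear_imp_linear[OF assms]
  by (auto simp: linear_conv_bounded_linear intro: bounded_linear_imp_has_derivative)

lemma holo_on_phi:
  fixes a :: "complex ^ 'n::finite"
  assumes a: "a \<in> ball 0 1"
  shows "holo_on (phi a) (ball 0 1)"
  unfolding holo_on_def
proof
  fix z :: "complex ^ 'n" assume z: "z \<in> ball 0 1"
  \<comment> \<open>With its linear terms collected in \<open>L\<close>, the map
    \<open>phi a\<close> is a scalar reciprocal times an affine map, so the product rule gives its
    derivative, which is visibly complex-linear.\<close>
  define L where "L z = proj a z + complex_of_real (sqrt (1 - (norm a)\<^sup>2)) *s (z - proj a z)" for z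
  have L: "Vector_Spaces.linear (*s) (*s) L"
    by (rule cscale_linearI)
       (simp_all add: L_def proj_def herm_simps vec_eq_iff algebra_simps add_divide_distrib)
  interpret L: Vector_Spaces.linear "(*s)" "(*s)" L by fact
  have phi: "phi a = (\<lambda>z. inverse (1 - herm z a) *s (a - L z))"
    by (rule ext) (simp add: phi_def L_def inverse_eq_divide diff_diff_add)
  have ne: "1 - herm z a \<noteq> 0" by (rule herm_ne_1[OF z a])
  have dh: "((\<lambda>z. 1 - herm z a) has_derivative (\<lambda>h. 0 - herm h a)) (at z within ball 0 1)"
    by (intro has_derivative_diff has_derivative_const bounded_linear_imp_has_derivative
        bounded_linear_herm_left)
  have dL: "((\<lambda>z. a - L z) has_derivative (\<lambda>h. 0 - L h)) (at z within ball 0 1)"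
    using cscale_linear_imp_linear[OF L]
    by (intro has_derivative_diff has_derivative_const bounded_linear_imp_has_derivative)
       (simp add: linear_conv_bounded_linear)
  have "Vector_Spaces.linear (*s) (*s)
    (\<lambda>h. inverse (1 - herm z a) *s (0 - L h)
       + (- (inverse (1 - herm z a) * (0 - herm h a) * inverse (1 - herm z a))) *s (a - L z))"
    by (rule cscale_linearI) (simp_all add: L.add L.scale herm_simps vec_eq_iff algebra_simps)
  with bounded_bilinear.FDERIV[OF bounded_bilinear_cscale Deriv.has_derivative_inverse[OF ne dh] dL]
  show "\<exists>D. (phi a has_derivative D) (at z within ball 0 1) \<and> Vector_Spaces.linear (*s) (*s) D"
    unfolding phi by blast
qed

text \<open>An explicit inverse \<open>g\<close> agrees with \<open>inv_into\<close> on the ball,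
  and \<open>holo_on\<close> depends only on the values there.\<close>

lemma aut_ballI:
  assumes f: "f ` ball 0 1 \<subseteq> ball 0 1" "holo_on f (ball 0 1)"
    and g: "g ` ball 0 1 \<subseteq> ball 0 1" "holo_on g (ball 0 1)"
    and gf: "\<And>z. z \<in> ball 0 1 \<Longrightarrow> g (f z) = z"
    and fg: "\<And>z. z \<in> ball 0 1 \<Longrightarrow> f (g z) = z"
  shows "f \<in> aut_ball"
proof -
  have b: "bij_betw f (ball 0 1) (ball 0 1)"
    using f(1) g(1) gf fg by (intro bij_betw_byWitness[of _ g]) auto
  have "g z = inv_into (ball 0 1) f z" if "z \<in> ball 0 1" for z
    using b fg[OF that] g(1) that by (metis bij_betw_inv_into_left image_subset_iff)
  then have "holo_on (inv_into (ball 0 1) f) (ball 0 1)"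
    using holo_on_cong g(2) by blast
  with b f(2) show ?thesis by (simp add: aut_ball_def)
qed

lemma aut_ballE:
  assumes "f \<in> aut_ball"
  obtains g where "f ` ball 0 1 \<subseteq> ball 0 1" "holo_on f (ball 0 1)"
    "g ` ball 0 1 \<subseteq> ball 0 1" "holo_on g (ball 0 1)"
    "\<forall>z\<in>ball 0 1. g (f z) = z" "\<forall>z\<in>ball 0 1. f (g z) = z"
proof
  let ?g = "inv_into (ball 0 1) f"
  have b: "bij_betw f (ball 0 1) (ball 0 1)" using assms by (simp add: aut_ball_def)
  show "f ` ball 0 1 \<subseteq> ball 0 1" "?g ` ball 0 1 \<subseteq> ball 0 1"
    using bij_betw_imp_surj_on[OF b] bij_betw_imp_surj_on[OF bij_betw_inv_into[OF b]] by simp_all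
  show "holo_on f (ball 0 1)" "holo_on ?g (ball 0 1)" using assms by (simp_all add: aut_ball_def)
  show "\<forall>z\<in>ball 0 1. ?g (f z) = z" using b by (simp add: bij_betw_inv_into_left)
  show "\<forall>z\<in>ball 0 1. f (?g z) = z" using b by (simp add: bij_betw_inv_into_right)
qed

lemma aut_ball_compose:
  assumes "f \<in> aut_ball" "h \<in> aut_ball"
  shows "h \<circ> f \<in> aut_ball"
proof -
  obtain f' where f: "f ` ball 0 1 \<subseteq> ball 0 1" "holo_on f (ball 0 1)"
    "f' ` ball 0 1 \<subseteq> ball 0 1" "holo_on f' (ball 0 1)"
    "\<forall>z\<in>ball 0 1. f' (f z) = z" "\<forall>z\<in>ball 0 1. f (f' z) = z"
    using assms(1) by (rule aut_ballE)
  obtain h' where h: "h ` ball 0 1 \<subseteq> ball 0 1" "holo_on h (ball 0 1)"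
    "h' ` ball 0 1 \<subseteq> ball 0 1" "holo_on h' (ball 0 1)"
    "\<forall>z\<in>ball 0 1. h' (h z) = z" "\<forall>z\<in>ball 0 1. h (h' z) = z"
    using assms(2) by (rule aut_ballE)
  show ?thesis
  proof (rule aut_ballI[where g = "f' \<circ> h'"])
    show "holo_on (h \<circ> f) (ball 0 1)" using f(2) h(2) f(1) by (rule holo_on_compose)
    show "holo_on (f' \<circ> h') (ball 0 1)" using h(4) f(4) h(3) by (rule holo_on_compose)
  qed (use f(1,3,5,6) h(1,3,5,6) in \<open>auto simp: image_subset_iff\<close>)
qed

lemma phi_aut_ball: "a \<in> ball 0 1 \<Longrightarrow> phi a \<in> aut_ball"
  by (rule aut_ballI[where g = "phi a"])
     (use phi_in_ball phi_phi in \<open>blast intro: holo_on_phi\<close>)+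

section \<open>Unitary maps\<close>

text \<open>Stated as a linear isometry: polarisation then gives invariance of \<open>herm\<close>,
  and finite dimension gives surjectivity.\<close>

definition unitary_map :: "(complex ^ 'n::finite \<Rightarrow> complex ^ 'n) \<Rightarrow> bool" where
  "unitary_map U \<longleftrightarrow> Vector_Spaces.linear (*s) (*s) U \<and> (\<forall>z. norm (U z) = norm z)"

lemma unitary_map_compose: "unitary_map U \<Longrightarrow> unitary_map V \<Longrightarrow> unitary_map (V \<circ> U)"
  unfolding unitary_map_def using Vector_Spaces.linear_compose by fastforce

text \<open>Polarisation: the norm of \<open>z + w\<close> determines the real part of the product,
  and replacing \<open>w\<close> by \<open>\<i> *s w\<close> gives the imaginary part.\<close>

lemma unitary_map_herm:
  fixes U :: "complex ^ 'n::finite \<Rightarrow> complex ^ 'n"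
  assumes "unitary_map U"
  shows "herm (U z) (U w) = herm z w"
proof -
  interpret U: Vector_Spaces.linear "(*s)" "(*s)" U using assms by (simp add: unitary_map_def)
  have n: "norm (U z) = norm z" for z using assms by (simp add: unitary_map_def)
  have Re: "Re (herm (U z) (U w)) = Re (herm z w)" for z w
    unfolding Re_herm using n[of "z + w"] n[of z] n[of w]
    by (simp add: U.add norm_eq_sqrt_inner inner_add inner_commute)
  have "Im (herm x y) = Re (herm x (\<i> *s y))" for x y :: "complex ^ 'n"
    by (simp add: herm_scale_right)
  then show ?thesis using Re[of z w] Re[of z "\<i> *s w"] by (simp add: complex_eq_iff U.scale)
qed

lemma unitary_map_aut_ball:
  assumes U: "unitary_map U"
  shows "U \<in> aut_ball"
proof -
  have lin: "Vector_Spaces.linear (*s) (*s) U" and n: "norm (U z) = norm z" for z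
    using U by (simp_all add: unitary_map_def)
  interpret U: Vector_Spaces.linear "(*s)" "(*s)" U by fact
  have inj: "inj U"
    by (rule injI) (metis n U.diff norm_eq_zero right_minus_eq)
  have surj: "surj U" by (rule vec.linear_inj_imp_surj[OF lin inj])
  define V where "V = inv U"
  have UV: "U (V z) = z" and VU: "V (U z) = z" for z
    using inj surj by (simp_all add: V_def surj_f_inv_f)
  have linV: "Vector_Spaces.linear (*s) (*s) V"
    by (rule cscale_linearI) (metis UV VU U.add, metis UV VU U.scale)
  have nV: "norm (V z) = norm z" for z by (metis UV n)
  show ?thesis
    by (rule aut_ballI[where g = V]) (auto simp: n nV UV VU intro!: holo_on_linear lin linV)
qed

section \<open>The Schwarz lemma and automorphisms fixing the origin\<close>

text \<open>Reduces to one complex variable: since the derivative \<open>D\<close> is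
  complex-linear, the paired slice has as derivative multiplication by the number
  \<open>herm (D u) v\<close>.\<close>

lemma slice_holomorphic:
  assumes f: "holo_on f (ball 0 1)" and u: "norm u = 1"
  shows "(\<lambda>t. herm (f (t *s u)) v) holomorphic_on ball 0 1"
  unfolding holomorphic_on_def
proof
  fix t :: complex assume t: "t \<in> ball 0 1"
  have sub: "(\<lambda>t. t *s u) ` ball 0 1 \<subseteq> ball 0 1" using u by (auto simp: norm_cscale)
  then have "t *s u \<in> ball 0 1" using t by blast
  with f obtain D where D: "(f has_derivative D) (at (t *s u) within ball 0 1)"
    "Vector_Spaces.linear (*s) (*s) D" by (rule holo_onD)
  interpret D: Vector_Spaces.linear "(*s)" "(*s)" D by fact
  have "((\<lambda>t. t *s u) has_derivative (\<lambda>h. h *s u)) (at t within ball 0 1)"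
    using bounded_bilinear.bounded_linear_left[OF bounded_bilinear_cscale]
    by (rule bounded_linear_imp_has_derivative)
  then have "(f \<circ> (\<lambda>t. t *s u) has_derivative D \<circ> (\<lambda>h. h *s u)) (at t within ball 0 1)"
    by (rule diff_chain_within) (rule has_derivative_subset[OF D(1) sub])
  moreover have "(\<lambda>h. h * herm (D u) v) = (*) (herm (D u) v)"
    by (rule ext) simp
  ultimately
  have "((\<lambda>t. herm (f (t *s u)) v) has_derivative (*) (herm (D u) v)) (at t within ball 0 1)"
    using bounded_linear.has_derivative[OF bounded_linear_herm_left, of "f \<circ> (\<lambda>t. t *s u)" _ _ v]
    by (fastforce simp: o_def D.scale herm_scale_left)
  then show "(\<lambda>t. herm (f (t *s u)) v) field_differentiable at t within ball 0 1"
    unfolding field_differentiable_def has_field_derivative_def by blast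
qed

lemma unit_scale:
  assumes "z \<noteq> (0 :: complex ^ 'n::finite)"
  obtains u where "norm u = 1" "z = complex_of_real (norm z) *s u"
proof
  show "norm (complex_of_real (1 / norm z) *s z) = 1"
    using assms by (simp only: norm_cscale norm_of_real) simp
  show "z = complex_of_real (norm z) *s (complex_of_real (1 / norm z) *s z)"
    using assms by simp
qed

lemma slice_bound:
  fixes f :: "complex ^ 'n::finite \<Rightarrow> complex ^ 'm::finite"
  assumes "f ` ball 0 1 \<subseteq> ball 0 1" "norm u = 1" "norm v = 1" "norm t < 1"
  shows "norm (herm (f (t *s u)) v) < 1"
proof -
  have "t *s u \<in> ball 0 1" using assms by (simp add: norm_cscale)
  then have "norm (f (t *s u)) < 1" using assms(1) by (auto simp: image_subset_iff)
  then show ?thesis using norm_herm_le[of "f (t *s u)" v] assms(3) by simp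
qed

text \<open>Let \<open>u\<close> and \<open>v\<close> be the directions of \<open>z\<close> and
  \<open>f z\<close>. The component of \<open>f (t *s u)\<close> along \<open>v\<close> maps the
  disc to itself, fixes 0 and equals \<open>norm (f z)\<close> at \<open>t = norm z\<close>, so the
  one-variable Schwarz lemma applies.\<close>

lemma ball_schwarz:
  assumes f: "holo_on f (ball 0 1)" "f ` ball 0 1 \<subseteq> ball 0 1" "f 0 = 0" and z: "z \<in> ball 0 1"
  shows "norm (f z) \<le> norm z"
proof (cases "z = 0 \<or> f z = 0")
  case False
  then obtain u v where u: "norm u = 1" "z = complex_of_real (norm z) *s u"
    and v: "norm v = 1" "f z = complex_of_real (norm (f z)) *s v"
    using unit_scale by metis
  let ?h = "\<lambda>t. herm (f (t *s u)) v"
  have "norm (?h (complex_of_real (norm z))) \<le> norm (complex_of_real (norm z))"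
    by (rule Schwarz_Lemma(1)) (use f z u v slice_holomorphic slice_bound in auto)
  moreover have "?h (complex_of_real (norm z)) = complex_of_real (norm (f z))"
    using u(2) v by (metis herm_scale_left herm_self mult.right_neutral of_real_1 one_power2)
  ultimately show ?thesis by simp
qed (use f in auto)

text \<open>If the slice through \<open>z\<close> attains equality in the Schwarz lemma, then \<open>f\<close> maps the disc
  through \<open>z\<close> linearly, because the component of \<open>f (t u)\<close> along \<open>v\<close> already has full length.\<close>

lemma norm_preserving_disc:
  assumes f: "holo_on f (ball 0 1)" "f ` ball 0 1 \<subseteq> ball 0 1" "f 0 = 0"
    and n: "\<And>z. z \<in> ball 0 1 \<Longrightarrow> norm (f z) = norm z" and u: "norm u = 1"
  obtains w where "norm w = 1" "\<And>t. norm t < 1 \<Longrightarrow> f (t *s u) = t *s w"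
proof -
  let ?z = "(1 / 2) *s u"
  \<comment> \<open>One nonzero point of the disc suffices to test for equality in the Schwarz
    lemma; the midpoint of the radius is chosen.\<close>
  have z: "?z \<in> ball 0 1" "norm ?z = 1 / 2" using u by (simp_all add: norm_cscale)
  with n have fz: "norm (f ?z) = 1 / 2" by simp
  then have "f ?z \<noteq> 0" by auto
  then obtain v where v: "norm v = 1" "f ?z = complex_of_real (norm (f ?z)) *s v"
    using unit_scale by blast
  let ?h = "\<lambda>t. herm (f (t *s u)) v"
  have "norm (?h (1 / 2)) = norm (1 / 2 :: complex)"
    by (subst v(2)) (simp add: fz herm_scale_left herm_self v(1))
  then have "\<exists>z. norm z < 1 \<and> z \<noteq> 0 \<and> norm (?h z) = norm z"
    by (intro exI[of _ "1 / 2"]) simp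
  then obtain c where c: "\<And>t. norm t < 1 \<Longrightarrow> ?h t = c * t" "norm c = 1"
    using Schwarz_Lemma(3)[of ?h 0] slice_holomorphic[OF f(1) u] slice_bound[OF f(2) u v(1)] f(3)
    by auto
  show ?thesis
  proof
    show "norm (c *s v) = 1" using c v by (simp add: norm_cscale)
    fix t :: complex assume t: "norm t < 1"
    define y where "y = f (t *s u)"
    have "t *s u \<in> ball 0 1" using t u by (simp add: norm_cscale)
    then have ny: "norm y = norm t" using n u by (simp add: y_def norm_cscale)
    have hy: "herm y v = c * t" using c(1)[OF t] by (simp add: y_def)
    have cc: "cnj c * c = 1" using c(2) by (simp add: complex_norm_square[symmetric] mult.commute)
    have tt: "cnj t * t = complex_of_real ((norm t)\<^sup>2)"
      by (simp add: complex_norm_square mult.commute del: of_real_power)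
    have hv: "herm v y = cnj (c * t)" using hy herm_commute by metis
    \<comment> \<open>The squared distance from \<open>y\<close> to its expected value is
      \<open>|t|^2 - |c|^2 |t|^2\<close>, which vanishes as \<open>|c| = 1\<close>.\<close>
    have "herm (y - (c * t) *s v) (y - (c * t) *s v)
        = complex_of_real ((norm t)\<^sup>2) - (cnj c * c) * (cnj t * t)"
      using v(1) ny unfolding herm_simps hy hv by (simp add: herm_self algebra_simps)
    then have "y - (c * t) *s v = 0" unfolding cc tt by (simp flip: herm_self_eq_0_iff)
    then show "f (t *s u) = t *s (c *s v)" by (simp add: y_def mult.commute)
  qed
qed

text \<open>Norm preservation makes \<open>f\<close> linear on each disc through the origin. The
  slopes of these discs are the values of a single linear map, the derivative at 0, so
  \<open>f\<close> is linear on the whole ball.\<close>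

lemma aut_ball_fixing_0:
  assumes f: "f \<in> aut_ball" and f0: "f 0 = 0"
  obtains D where "unitary_map D" "\<And>z. z \<in> ball 0 1 \<Longrightarrow> f z = D z"
proof -
  obtain g where A: "f ` ball 0 1 \<subseteq> ball 0 1" "holo_on f (ball 0 1)"
    "g ` ball 0 1 \<subseteq> ball 0 1" "holo_on g (ball 0 1)"
    "\<forall>z\<in>ball 0 1. g (f z) = z"
    using f by (rule aut_ballE)
  have g0: "g 0 = 0" using A(5)[rule_format, of 0] f0 by simp
  have n: "norm (f z) = norm z" if z: "z \<in> ball 0 1" for z
  proof (rule antisym)
    show "norm (f z) \<le> norm z" by (rule ball_schwarz[OF A(2,1) f0 z])
    have "norm (g (f z)) \<le> norm (f z)" using A(1) z by (intro ball_schwarz[OF A(4,3) g0]) blast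
    then show "norm z \<le> norm (f z)" using A(5) z by simp
  qed
  obtain D where D: "(f has_derivative D) (at 0 within ball 0 1)" "Vector_Spaces.linear (*s) (*s) D"
    using A(2) by (rule holo_onD) auto
  interpret D: Vector_Spaces.linear "(*s)" "(*s)" D by fact
  have D': "(f has_derivative D) (at 0)" using D(1) by (simp add: at_within_open[OF _ open_ball])
  have Du: "norm (D u) = 1 \<and> (\<forall>t. norm t < 1 \<longrightarrow> f (t *s u) = t *s D u)" if u: "norm u = 1" for u
  proof -
    obtain w where w: "norm w = 1" "\<And>t. norm t < 1 \<Longrightarrow> f (t *s u) = t *s w"
      using norm_preserving_disc[OF A(2,1) f0 n u] by metis
    \<comment> \<open>The derivative of \<open>f\<close> along the real ray through \<open>u\<close>
      is computed twice: the chain rule gives \<open>D u\<close>, the formula on the disc gives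
      \<open>w\<close>. Uniqueness of derivatives identifies them.\<close>
    have "((\<lambda>t. t *\<^sub>R u) has_derivative (\<lambda>h. h *\<^sub>R u)) (at (0::real))"
      by (intro bounded_linear_imp_has_derivative bounded_linear_scaleR_left)
    then have "(f \<circ> (\<lambda>t. t *\<^sub>R u) has_derivative D \<circ> (\<lambda>h. h *\<^sub>R u)) (at (0::real))"
      by (rule diff_chain_at) (simp add: D')
    then have 1: "((\<lambda>t. f (t *\<^sub>R u)) has_derivative (\<lambda>h. D (h *\<^sub>R u))) (at (0::real) within ball 0 1)"
      using has_derivative_at_withinI by (auto simp: o_def)
    have "((\<lambda>t. t *\<^sub>R w) has_derivative (\<lambda>h. D (h *\<^sub>R u))) (at (0::real) within ball 0 1)"
      by (rule has_derivative_transform[OF _ _ 1]) (auto simp: scaleR_eq_cscale w)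
    then have 1: "((\<lambda>t. t *\<^sub>R w) has_derivative (\<lambda>h. D (h *\<^sub>R u))) (at (0::real))"
      by (simp add: at_within_open[OF _ open_ball])
    have 2: "((\<lambda>t. t *\<^sub>R w) has_derivative (\<lambda>h. h *\<^sub>R w)) (at (0::real))"
      by (intro bounded_linear_imp_has_derivative bounded_linear_scaleR_left)
    have "D (1 *\<^sub>R u) = 1 *\<^sub>R w" using has_derivative_unique[OF 1 2] by meson
    then show ?thesis using w by simp
  qed
  have "f z = D z" if z: "z \<in> ball 0 1" for z
  proof (cases "z = 0")
    case False
    then obtain u where u: "norm u = 1" "z = complex_of_real (norm z) *s u" by (rule unit_scale)
    have "norm (complex_of_real (norm z)) < 1" using z by simp
    then show ?thesis using Du[OF u(1)] u(2) by (metis D.scale)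
  qed (simp add: f0 D.zero)
  moreover have "norm (D z) = norm z" for z
  proof (cases "z = 0")
    case False
    then obtain u where u: "norm u = 1" "z = complex_of_real (norm z) *s u" by (rule unit_scale)
    then show ?thesis using Du[OF u(1)] by (metis D.scale norm_cscale)
  qed (simp add: D.zero)
  ultimately show ?thesis using that D(2) by (auto simp: unitary_map_def)
qed

text \<open>Composing \<open>f\<close> with the involutions at \<open>x\<close> and
  \<open>f x\<close> yields an automorphism fixing 0, hence a unitary map on the ball; evaluating it
  at \<open>phi x y\<close> and cancelling the double involution gives the formula.\<close>

lemma aut_ball_pseudo_unitary:
  assumes f: "f \<in> aut_ball" and x: "x \<in> ball 0 1"
  obtains U where "unitary_map U" "\<And>y. y \<in> ball 0 1 \<Longrightarrow> phi (f x) (f y) = U (phi x y)"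
proof -
  have fx: "f y \<in> ball 0 1" if "y \<in> ball 0 1" for y
    using f that by (meson aut_ballE image_subset_iff)
  have "phi (f x) \<circ> f \<circ> phi x \<in> aut_ball"
    using phi_aut_ball x fx f aut_ball_compose by metis
  moreover have "(phi (f x) \<circ> f \<circ> phi x) 0 = 0" by (simp add: phi_0_right phi_self)
  ultimately obtain U where U: "unitary_map U"
      "\<And>z. z \<in> ball 0 1 \<Longrightarrow> (phi (f x) \<circ> f \<circ> phi x) z = U z"
    using aut_ball_fixing_0 by blast
  have "phi (f x) (f y) = U (phi x y)" if "y \<in> ball 0 1" for y
    using U(2)[OF phi_in_ball[OF x that]] by (simp add: phi_phi[OF x that])
  with U(1) show ?thesis using that by blast
qed

section \<open>Families with equal Gram matrices\<close>

text \<open>\<open>W\<close> is the complex reflection along \<open>d = u - v\<close>; it is unitary because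
  \<open>|u| = |v|\<close> forces \<open>2 Re \<langle>\<langle>u, d\<rangle>\<rangle> = |d|\<^sup>2\<close>.\<close>

lemma unitary_reflection:
  assumes n: "norm u = norm v"
  obtains W where "unitary_map W" "W u = v" "\<And>z. herm z u = herm z v \<Longrightarrow> W z = z"
proof (cases "u = v")
  case True
  have "unitary_map (\<lambda>z. z)" by (auto simp: unitary_map_def intro: cscale_linearI)
  then show ?thesis using that True by blast
next
  case False
  define d where "d = u - v"
  \<comment> \<open>Chosen so that \<open>W u = u - d = v\<close>. The factor is complex in general,
    as equal norms fix only the real part of \<open>herm u d\<close>.\<close>
  define c where "c = 1 / herm u d"
  define W where "W z = z - (c * herm z d) *s d" for z
  have "Re (2 * herm u d) = (norm d)\<^sup>2"
    using n by (simp add: d_def Re_herm power2_norm_eq_inner inner_diff inner_commute norm_eq)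
  moreover have "norm d \<noteq> 0" using False by (simp add: d_def)
  ultimately have ud: "herm u d \<noteq> 0" by auto
  have "herm u d + cnj (herm u d) = herm d d"
    using \<open>Re (2 * herm u d) = _\<close> by (simp add: complex_eq_iff herm_self del: of_real_power)
  \<comment> \<open>This relation cancels the two correction terms in the expansion of
    \<open>herm (W z) (W z)\<close>.\<close>
  then have cc: "c + cnj c = c * cnj c * herm d d"
    using ud by (simp add: c_def field_simps)
  have "herm (W z) (W z) = herm z z" for z
  proof -
    have "herm d z = cnj (herm z d)" by (rule herm_commute)
    then have "herm (W z) (W z) = herm z z - (c + cnj c) * herm z d * cnj (herm z d)
      + c * cnj c * herm d d * herm z d * cnj (herm z d)"
      by (simp add: W_def herm_simps algebra_simps)
    then show ?thesis unfolding cc by simp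
  qed
  then have "norm (W z) = norm z" for z
    unfolding herm_self by (metis norm_ge_zero of_real_eq_iff power2_eq_iff_nonneg)
  moreover have "Vector_Spaces.linear (*s) (*s) W"
    by (rule cscale_linearI) (simp_all add: W_def herm_simps vec_eq_iff algebra_simps)
  ultimately have "unitary_map W" by (simp add: unitary_map_def)
  moreover have "W u = v" using ud by (simp add: W_def c_def d_def)
  moreover have "W z = z" if "herm z u = herm z v" for z
    using that by (simp add: W_def d_def herm_diff_right)
  ultimately show ?thesis using that by blast
qed

text \<open>Each step follows \<open>U\<close> by the reflection taking \<open>U (u k)\<close> to
  \<open>v k\<close>. Vectors \<open>v i\<close> already in place stay fixed, since equality of the
  Gram matrices gives them the same product with both. Linearly dependent families are covered
  too.\<close>

lemma gram_eq_imp_unitary: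
  fixes u v :: "'k \<Rightarrow> complex ^ 'n::finite"
  assumes "finite S" and "\<And>i j. i \<in> S \<Longrightarrow> j \<in> S \<Longrightarrow> herm (u i) (u j) = herm (v i) (v j)"
  shows "\<exists>U. unitary_map U \<and> (\<forall>i\<in>S. U (u i) = v i)"
  using assms
proof (induction S rule: finite_induct)
  case empty
  have "unitary_map (\<lambda>z :: complex ^ 'n. z)" by (auto simp: unitary_map_def intro: cscale_linearI)
  then show ?case by blast
next
  case (insert k S)
  then obtain U where U: "unitary_map U" "\<forall>i\<in>S. U (u i) = v i" by auto
  have "herm (U (u k)) (U (u k)) = herm (v k) (v k)"
    using U(1) insert.prems by (simp add: unitary_map_herm)
  then have "norm (U (u k)) = norm (v k)"
    unfolding herm_self by (metis norm_ge_zero of_real_eq_iff power2_eq_iff_nonneg)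
  then obtain W where W: "unitary_map W" "W (U (u k)) = v k"
    "\<And>z. herm z (U (u k)) = herm z (v k) \<Longrightarrow> W z = z" by (rule unitary_reflection) blast
  have "W (v i) = v i" if "i \<in> S" for i
  proof (rule W(3))
    have "herm (v i) (U (u k)) = herm (U (u i)) (U (u k))" using U(2) that by simp
    then show "herm (v i) (U (u k)) = herm (v i) (v k)"
      using U(1) insert.prems that by (simp add: unitary_map_herm)
  qed
  then have "\<forall>i\<in>insert k S. (W \<circ> U) (u i) = v i" using U(2) W(2) by auto
  then show ?case using unitary_map_compose[OF U(1) W(1)] by blast
qed

section \<open>Positive semidefinite matrices as Gram matrices\<close>

lemma herm_matrix_vector_mult: "herm (A *v v) w = (\<Sum>i\<in>UNIV. \<Sum>j\<in>UNIV. A $ i $ j * v $ j * cnj (w $ i))"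
  by (simp add: herm_def matrix_vector_mult_def sum_distrib_right)

text \<open>The quadratic form at \<open>v\<close> is the squared norm of the combination of the
  \<open>u i\<close> with coefficients \<open>cnj (v $ i)\<close>.\<close>

lemma psd_gram:
  fixes u :: "'n::finite \<Rightarrow> complex ^ 'm::finite"
  shows "psd (\<chi> i j. herm (u i) (u j))"
  unfolding psd_def
proof safe
  fix i j
  show "(\<chi> i j. herm (u i) (u j)) $ j $ i = cnj ((\<chi> i j. herm (u i) (u j)) $ i $ j)"
    using herm_commute by auto
next
  fix v :: "complex ^ 'n"
  let ?s = "\<Sum>i\<in>UNIV. cnj (v $ i) *s u i"
  have "herm ((\<chi> i j. herm (u i) (u j)) *v v) v = herm ?s ?s"
    unfolding herm_matrix_vector_mult herm_sum_left herm_sum_right herm_scale_left herm_scale_right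
    by (subst sum.swap) (simp add: mult_ac sum_distrib_left)
  then show "0 \<le> Re (herm ((\<chi> i j. herm (u i) (u j)) *v v) v)"
    by (simp add: Re_herm)
qed

lemma herm_axis: "herm x (axis k c) = x $ k * cnj c"
proof -
  have "herm x (axis k c) = (\<Sum>i\<in>UNIV. if i = k then x $ i * cnj c else 0)"
    unfolding herm_def by (rule sum.cong) (auto simp: axis_def)
  then show ?thesis by simp
qed

lemma matrix_vector_mult_axis: "(A *v axis k c) $ i = A $ i $ k * (c :: complex)"
proof -
  have "(A *v axis k c) $ i = (\<Sum>j\<in>UNIV. if j = k then A $ i $ j * c else 0)"
    unfolding matrix_vector_mult_def vec_lambda_beta by (rule sum.cong) (auto simp: axis_def)
  then show ?thesis by simp
qed

text \<open>Expands the quadratic form in one coordinate direction, so that a suitable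
  \<open>t\<close> can be chosen: to force a negative value when a diagonal entry is zero, or to
  complete the square at a pivot.\<close>

lemma hermitian_add_axis:
  fixes A :: "complex ^ 'n::finite ^ 'n" and k :: 'n
  assumes "\<And>i j. A $ j $ i = cnj (A $ i $ j)"
  defines "r v \<equiv> (A *v v) $ k"
  shows "herm (A *v (v + axis k t)) (v + axis k t)
    = herm (A *v v) v + r v * cnj t + cnj (r v) * t + A $ k $ k * t * cnj t"
proof -
  have "herm (A *v axis k t) v = (\<Sum>i\<in>UNIV. A $ i $ k * t * cnj (v $ i))"
    by (simp add: herm_def matrix_vector_mult_axis)
  also have "\<dots> = cnj (r v) * t"
    unfolding r_def matrix_vector_mult_def
    by (simp add: sum_distrib_left assms(1)[of _ k] mult_ac)
  finally show ?thesis
    by (simp add: matrix_vector_right_distrib herm_simps herm_axis matrix_vector_mult_axis r_def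
        algebra_simps)
qed

lemma psd_hermitian: "psd A \<Longrightarrow> A $ j $ i = cnj (A $ i $ j)"
  unfolding psd_def by blast

lemma psd_nonneg: "psd A \<Longrightarrow> 0 \<le> Re (herm (A *v v) v)"
  unfolding psd_def by blast

lemma psd_diag_nonneg:
  assumes "psd A"
  shows "A $ k $ k = complex_of_real (Re (A $ k $ k))" "0 \<le> Re (A $ k $ k)"
proof -
  have "A $ k $ k = cnj (A $ k $ k)" using assms by (rule psd_hermitian)
  then show "A $ k $ k = complex_of_real (Re (A $ k $ k))" by (simp add: complex_eq_iff)
  have "0 \<le> Re (herm (A *v axis k 1) (axis k 1))" using assms by (rule psd_nonneg)
  then show "0 \<le> Re (A $ k $ k)" by (simp add: herm_axis matrix_vector_mult_axis)
qed

text \<open>On the vectors \<open>axis i 1 + axis k t\<close> the form is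
  \<open>b + 2 * Re (a * cnj t)\<close>, which takes negative values unless
  \<open>a = 0\<close>.\<close>

lemma psd_zero_diag:
  assumes A: "psd A" and 0: "A $ k $ k = 0"
  shows "A $ i $ k = 0"
proof -
  have h: "A $ j $ i = cnj (A $ i $ j)" for i j using A by (rule psd_hermitian)
  define a where "a = A $ k $ i"
  define b where "b = Re (A $ i $ i)"
  have "a = 0"
  proof (rule ccontr)
    assume a: "a \<noteq> 0"
    \<comment> \<open>This makes \<open>a * cnj t\<close> equal to \<open>- (b + 1)\<close>, so the
      form takes the value \<open>- b - 2\<close>, negative because \<open>b\<close> is a
      nonnegative diagonal entry.\<close>
    define t where "t = complex_of_real (- (b + 1) / (norm a)\<^sup>2) * a"
    have "a * cnj t = complex_of_real (- (b + 1) / (norm a)\<^sup>2) * (a * cnj a)"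
      by (simp add: t_def)
    also have "\<dots> = complex_of_real (- (b + 1))"
      using a unfolding complex_norm_square[symmetric] of_real_mult[symmetric] by simp
    finally have t: "a * cnj t = complex_of_real (- (b + 1))" .
    have "0 \<le> Re (herm (A *v (axis i 1 + axis k t)) (axis i 1 + axis k t))"
      using A by (rule psd_nonneg)
    also have "\<dots> = b + 2 * Re (a * cnj t)"
      unfolding hermitian_add_axis[OF h] by (simp add: 0 herm_axis matrix_vector_mult_axis a_def b_def)
    finally have "0 \<le> b - 2 * (b + 1)" unfolding t by simp
    then show False using psd_diag_nonneg(2)[OF A, of i] by (simp add: b_def)
  qed
  then show ?thesis using h[of i k] by (simp add: a_def)
qed

text \<open>Eliminating the pivot \<open>k\<close>: the quadratic form of the Schur complement at \<open>v\<close> is the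
  minimum of the form of \<open>A\<close> over the line \<open>v + t e\<^sub>k\<close>.\<close>

lemma psd_schur_complement:
  assumes A: "psd A" and k: "A $ k $ k \<noteq> 0"
  shows "psd (\<chi> i j. A $ i $ j - A $ i $ k * A $ k $ j / A $ k $ k)"
    (is "psd ?B")
  unfolding psd_def
proof safe
  have h: "A $ j $ i = cnj (A $ i $ j)" for i j using A by (rule psd_hermitian)
  fix i j
  show "?B $ j $ i = cnj (?B $ i $ j)"
    using h[of i j] h[of i k] h[of k j] h[of k k] by simp
next
  have h: "A $ j $ i = cnj (A $ i $ j)" for i j using A by (rule psd_hermitian)
  fix v :: "complex ^ 'a"
  define p where "p = A $ k $ k"
  have p: "cnj p = p" "p \<noteq> 0" using h[of k k] k by (simp_all add: p_def)
  define r where "r = (A *v v) $ k"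
  have r': "(\<Sum>i\<in>UNIV. A $ i $ k * cnj (v $ i)) = cnj r"
    unfolding r_def matrix_vector_mult_def by (simp add: h[of _ k])
  have "herm (?B *v v) v = herm (A *v v) v
      - (\<Sum>i\<in>UNIV. \<Sum>j\<in>UNIV. (A $ i $ k * cnj (v $ i)) * (A $ k $ j * v $ j)) / p"
    unfolding herm_matrix_vector_mult p_def
    by (simp add: sum_subtractf[symmetric] sum_divide_distrib algebra_simps)
  also have "(\<Sum>i\<in>UNIV. \<Sum>j\<in>UNIV. (A $ i $ k * cnj (v $ i)) * (A $ k $ j * v $ j))
      = cnj r * r"
    unfolding sum_product[symmetric] r' by (simp add: r_def matrix_vector_mult_def)
  \<comment> \<open>Completing the square in \<open>t\<close>: the minimum is attained at
    \<open>t = - r / p\<close>.\<close>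
  also have "herm (A *v v) v - cnj r * r / p
      = herm (A *v (v + axis k (- r / p))) (v + axis k (- r / p))"
    unfolding hermitian_add_axis[OF h] using p by (simp add: flip: p_def r_def)
  finally show "0 \<le> Re (herm (?B *v v) v)" using psd_nonneg[OF A] by simp
qed

text \<open>The set \<open>S\<close> bounds both the nonzero rows of \<open>A\<close> and the
  coordinates used by the Gram vectors. Eliminating a nonzero pivot \<open>k\<close> makes row
  \<open>k\<close> vanish and leaves coordinate \<open>k\<close> free to restore the subtracted
  rank-one matrix.\<close>

lemma psd_gram_supported:
  fixes A :: "complex ^ 'n::finite ^ 'n"
  assumes "finite S" "psd A" "\<And>i j. i \<notin> S \<Longrightarrow> A $ i $ j = 0"
  shows "\<exists>u :: 'n \<Rightarrow> complex ^ 'n. (\<forall>i k. k \<notin> S \<longrightarrow> u i $ k = 0) \<and> (\<forall>i j. A $ i $ j = herm (u i) (u j))"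
  using assms
proof (induction S arbitrary: A rule: finite_induct)
  case empty
  then show ?case by (intro exI[of _ "\<lambda>_. 0"]) simp
next
  case (insert k S)
  have h: "A $ j $ i = cnj (A $ i $ j)" for i j using insert.prems(1) by (rule psd_hermitian)
  show ?case
  proof (cases "A $ k $ k = 0")
    case True
    \<comment> \<open>A zero pivot forces column \<open>k\<close>, and by symmetry row
      \<open>k\<close>, to vanish, so the induction hypothesis applies to \<open>A\<close>
      itself.\<close>
    then have "A $ i $ k = 0" for i using psd_zero_diag insert.prems(1) by blast
    then have "A $ i $ j = 0" if "i \<notin> S" for i j
      using insert.prems(2) that h[of j k] by (cases "i = k") auto
    then obtain u :: "'n \<Rightarrow> complex ^ 'n" where
      "\<forall>i k. k \<notin> S \<longrightarrow> u i $ k = 0" "\<forall>i j. A $ i $ j = herm (u i) (u j)"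
      using insert.IH[OF insert.prems(1)] by blast
    then show ?thesis by (intro exI[of _ u]) auto
  next
    case False
    define B where "B = (\<chi> i j. A $ i $ j - A $ i $ k * A $ k $ j / A $ k $ k)"
    have "psd B" unfolding B_def by (rule psd_schur_complement[OF insert.prems(1) False])
    moreover have "B $ i $ j = 0" if "i \<notin> S" for i j
      using insert.prems(2) that False by (cases "i = k") (auto simp: B_def)
    ultimately obtain u :: "'n \<Rightarrow> complex ^ 'n" where
      u: "\<And>i k. k \<notin> S \<Longrightarrow> u i $ k = 0" "\<And>i j. B $ i $ j = herm (u i) (u j)"
      using insert.IH by blast
    define s where "s = complex_of_real (sqrt (Re (A $ k $ k)))"
    have s: "s * s = A $ k $ k" "cnj s = s"
      using psd_diag_nonneg[OF insert.prems(1), of k] by (simp_all add: s_def flip: of_real_mult)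
    \<comment> \<open>Coordinate \<open>k\<close> of each \<open>u i\<close> is zero, so no cross
      terms arise and the added entries contribute exactly
      \<open>A $ i $ k * A $ k $ j / A $ k $ k\<close>.\<close>
    define w where "w i = u i + axis k (A $ i $ k / s)" for i
    have c: "herm (axis k x) y = cnj (herm y (axis k x))" for x and y :: "complex ^ 'n"
      by (rule herm_commute)
    have "herm (w i) (w j) = A $ i $ j" for i j
    proof -
      have "herm (w i) (w j) = B $ i $ j + A $ i $ k * A $ k $ j / (s * s)"
        using u(1)[OF insert.hyps(2)] h[of j k]
        by (simp add: w_def herm_simps herm_axis c u(2) s(2))
      then show ?thesis by (simp add: s(1) B_def)
    qed
    moreover have "w i $ l = 0" if "l \<notin> insert k S" for i l
      using that u(1) by (simp add: w_def axis_def)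
    ultimately show ?thesis by (intro exI[of _ w]) auto
  qed
qed

lemma psd_imp_gram:
  fixes A :: "complex ^ 'n::finite ^ 'n"
  assumes "psd A"
  obtains u :: "'n \<Rightarrow> complex ^ 'n" where "\<And>i j. A $ i $ j = herm (u i) (u j)"
  using psd_gram_supported[of UNIV A] assms by auto

section \<open>Invariants of tuples and congruence\<close>

lemma phi_eq_0_iff:
  assumes "a \<in> ball 0 1" "z \<in> ball 0 1"
  shows "phi a z = 0 \<longleftrightarrow> z = a"
  using phi_phi[OF assms] by (metis phi_self phi_0_right)

text \<open>Undoes the normalisation in \<open>kos\<close>, recovering the Gram matrix from the two
  invariants. If one of the vectors is zero, both sides vanish.\<close>

lemma herm_phi_eq_kos:
  "herm (phi x y) (phi x z) = of_real (pseudohyp x y) * of_real (pseudohyp x z) * kos x y z"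
  by (cases "phi x y = 0 \<or> phi x z = 0")
     (auto simp: kos_def pseudohyp_def scaleR_eq_cscale herm_simps field_simps)

lemma kos_unitary:
  assumes "unitary_map U" "phi x' y' = U (phi x y)" "phi x' z' = U (phi x z)"
  shows "kos x' y' z' = kos x y z" "pseudohyp x' y' = pseudohyp x y"
  using assms unitary_map_herm[OF assms(1)]
  by (simp_all add: kos_def pseudohyp_def scaleR_eq_cscale herm_simps unitary_map_def)

lemma admissible_rho_bounds:
  assumes "admissible X"
  shows "0 < rho X $ i" "rho X $ i < 1"
proof -
  have n: "X (Some i) \<noteq> X None" and b: "X j \<in> ball 0 1" for j
    using assms unfolding admissible_def by blast+
  show "0 < rho X $ i" using n by (simp add: rho_def pseudohyp_def phi_eq_0_iff[OF b b])
  show "rho X $ i < 1" using phi_in_ball[OF b b] by (simp add: rho_def pseudohyp_def)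
qed

text \<open>The unit diagonal makes the Gram vectors of \<open>N\<close> unit vectors. With base
  point 0, the other points are these vectors rescaled to the lengths prescribed by
  \<open>\<sigma>\<close>.\<close>

lemma admissible_realisation:
  fixes \<sigma> :: "real ^ 'n::finite"
  assumes \<sigma>: "\<And>i. 0 < \<sigma> $ i \<and> \<sigma> $ i < 1" and diag: "\<And>i. N $ i $ i = 1" and "psd N"
  shows "\<exists>X :: 'n option \<Rightarrow> complex ^ 'n. admissible X \<and> kos_matrix X = N \<and> rho X = \<sigma>"
proof -
  obtain u :: "'n \<Rightarrow> complex ^ 'n" where u: "\<And>i j. N $ i $ j = herm (u i) (u j)"
    using psd_imp_gram[OF \<open>psd N\<close>] by metis
  have "complex_of_real ((norm (u i))\<^sup>2) = 1" for i
    using u[of i i] diag[of i] unfolding herm_self by simp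
  then have nu: "norm (u i) = 1" for i
    by (metis norm_ge_zero of_real_eq_1_iff power2_eq_1_iff neg_0_le_iff_le not_one_le_zero)
  \<comment> \<open>The sign compensates for \<open>phi 0 z = - z\<close>.\<close>
  define X where "X j = (case j of None \<Rightarrow> 0 | Some i \<Rightarrow> - (\<sigma> $ i *\<^sub>R u i))" for j
  have phi: "phi (X None) (X (Some i)) = \<sigma> $ i *\<^sub>R u i" for i
    by (simp add: X_def phi_0_left)
  have n: "norm (\<sigma> $ i *\<^sub>R u i) = \<sigma> $ i" for i using \<sigma>[of i] nu by simp
  have "admissible X"
    unfolding admissible_def
  proof safe
    show "X j \<in> ball 0 1" for j using n \<sigma> by (cases j) (auto simp: X_def)
    show False if "X (Some i) = X None" for i using that n[of i] \<sigma>[of i] by (auto simp: X_def)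
  qed
  moreover have su: "\<sigma> $ i *\<^sub>R u i /\<^sub>R \<sigma> $ i = u i" for i using \<sigma>[of i] by simp
  then have "kos_matrix X = N"
    unfolding kos_matrix_def kos_def phi n su by (simp add: vec_eq_iff u)
  moreover have "rho X = \<sigma>"
    unfolding rho_def pseudohyp_def phi n by (simp add: vec_eq_iff)
  ultimately show ?thesis by blast
qed

text \<open>A single unitary map carries all the vectors \<open>phi (X None) (X j)\<close> to those
  of \<open>Y\<close>, and it preserves lengths and products.\<close>

lemma congruent_imp_invariants_eq:
  assumes X: "admissible X" and "congruent_tuples X Y"
  shows "kos_matrix X = kos_matrix Y \<and> rho X = rho Y"
proof -
  obtain f where f: "f \<in> aut_ball" "\<And>j. f (X j) = Y j"
    using assms(2) unfolding congruent_tuples_def by blast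
  have b: "X j \<in> ball 0 1" for j using X unfolding admissible_def by blast
  obtain U where U: "unitary_map U"
      "\<And>y. y \<in> ball 0 1 \<Longrightarrow> phi (f (X None)) (f y) = U (phi (X None) y)"
    using f(1) b[of None] by (rule aut_ball_pseudo_unitary) blast
  have "phi (Y None) (Y j) = U (phi (X None) (X j))" for j
    using U(2)[OF b] by (simp add: f(2))
  from kos_unitary[OF U(1) this this] show ?thesis
    by (simp add: vec_eq_iff kos_matrix_def rho_def)
qed

lemma invariants_eq_imp_congruent:
  assumes X: "admissible X" and Y: "admissible Y"
    and M: "kos_matrix X = kos_matrix Y" and R: "rho X = rho Y"
  shows "congruent_tuples X Y"
proof -
  have bX: "X j \<in> ball 0 1" and bY: "Y j \<in> ball 0 1" for j
    using X Y unfolding admissible_def by blast+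
  let ?u = "\<lambda>i. phi (X None) (X (Some i))" and ?v = "\<lambda>i. phi (Y None) (Y (Some i))"
  have "kos (X None) (X (Some i)) (X (Some j)) = kos (Y None) (Y (Some i)) (Y (Some j))"
    "pseudohyp (X None) (X (Some i)) = pseudohyp (Y None) (Y (Some i))" for i j
    using M R by (simp_all add: kos_matrix_def rho_def vec_eq_iff)
  then have "herm (?u i) (?u j) = herm (?v i) (?v j)" for i j
    unfolding herm_phi_eq_kos by simp
  then obtain U where U: "unitary_map U" "\<And>i. U (?u i) = ?v i"
    using gram_eq_imp_unitary[of UNIV ?u ?v] by auto
  have U0: "U 0 = 0" using U(1) by (metis norm_eq_zero unitary_map_def)
  \<comment> \<open>Carry the base point of \<open>X\<close> to 0, rotate by \<open>U\<close>, then
    carry 0 to the base point of \<open>Y\<close>.\<close>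
  let ?f = "phi (Y None) \<circ> U \<circ> phi (X None)"
  have "?f \<in> aut_ball"
    using phi_aut_ball[OF bX] phi_aut_ball[OF bY] unitary_map_aut_ball[OF U(1)] aut_ball_compose
    by metis
  moreover have "?f (X j) = Y j" for j
    by (cases j) (simp_all add: phi_self U0 phi_0_right U(2) phi_phi[OF bY bY])
  ultimately show ?thesis unfolding congruent_tuples_def by blast
qed

theorem theorem5p1:
  shows
    "(\<forall>X :: 'n::finite option \<Rightarrow> complex ^ 'n. admissible X \<longrightarrow>
        (\<forall>i. 0 < rho X $ i \<and> rho X $ i < 1) \<and>
        (\<forall>i. kos_matrix X $ i $ i = 1) \<and>
        psd (kos_matrix X)) \<and>
     (\<forall>(\<sigma> :: real ^ 'n) (N :: complex ^ 'n ^ 'n).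
        (\<forall>i. 0 < \<sigma> $ i \<and> \<sigma> $ i < 1) \<and> (\<forall>i. N $ i $ i = 1) \<and> psd N \<longrightarrow>
        (\<exists>X :: 'n option \<Rightarrow> complex ^ 'n. admissible X \<and> kos_matrix X = N \<and> rho X = \<sigma>)) \<and>
     (\<forall>(X :: 'n option \<Rightarrow> complex ^ 'n) Y. admissible X \<and> admissible Y \<longrightarrow>
        (congruent_tuples X Y \<longleftrightarrow> kos_matrix X = kos_matrix Y \<and> rho X = rho Y))"
proof (intro conjI allI impI)
  fix X :: "'n option \<Rightarrow> complex ^ 'n" and i
  assume X: "admissible X"
  then show "0 < rho X $ i" "rho X $ i < 1" by (rule admissible_rho_bounds)+
  \<comment> \<open>Positivity of \<open>rho\<close> excludes the zero vector, whose normalisation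
    would give the diagonal entry 0.\<close>
  then have "phi (X None) (X (Some i)) \<noteq> 0" by (auto simp: rho_def pseudohyp_def)
  then show "kos_matrix X $ i $ i = 1"
    by (simp add: kos_matrix_def kos_def herm_self)
next
  fix X :: "'n option \<Rightarrow> complex ^ 'n"
  \<comment> \<open>\<open>kos_matrix X\<close> is the Gram matrix of the normalised
    vectors.\<close>
  show "psd (kos_matrix X)" unfolding kos_matrix_def kos_def by (rule psd_gram)
qed (use admissible_realisation congruent_imp_invariants_eq invariants_eq_imp_congruent in blast)+

end
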